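(* Let $X$ be a random variable with distribution $\mu$ and let $f$ be a real-valued measurable function on the space in which $X$ takes values. Then the function $$t \mapsto \Phi^{-1}\big(\mu\{f \leq t\}\big)$$ is concave on $\mathbb{R}$ if and only if there is a convex function $\varphi:\mathbb{R}\to\mathbb{R}$ such that $f(X)$ has the same distribution as $\varphi(Z)$, where $Z$ is a standard $\mathbb{R}$-valued Gaussian random variable.
   Context: $\Phi(t) = \int_{-\infty}^t e^{-x^2/2}\,\frac{dx}{\sqrt{2\pi}}$ is the standard normal distribution function and $\Phi^{-1}$ its inverse, extended by $\Phi^{-1}(0) = -\infty$ and $\Phi^{-1}(1) = +\infty$. Concavity of an extended-real-valued function $G$ means $G((1-\lambda)s+\lambda t) \ge (1-\lambda)G(s) + \lambda G(t)$ for all $\lambda\in(0,1)$ and all $s,t$ with $G(s),G(t) > -\infty$. *)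

theory Defs
  imports "HOL-Probability.Probability"
begin

definition Phi :: "real \<Rightarrow> real" where
  "Phi t = (LINT x:{..t}|lborel. exp (- (x\<^sup>2) / 2) / sqrt (2 * pi))"

text \<open>Only arguments in the closed unit interval are meaningful.\<close>

definition Phi_inv :: "real \<Rightarrow> ereal" where
  "Phi_inv p =
    (if p = 0 then - \<infinity> else if p = 1 then \<infinity> else ereal (inv_into UNIV Phi p))"

text \<open>The guards exclude the value \<open>-\<infinity>\<close>, so the sum on the left is never of
  the form \<open>\<infinity> - \<infinity>\<close>; the value \<open>\<infinity>\<close> is allowed.\<close>

definition ext_concave :: "(real \<Rightarrow> ereal) \<Rightarrow> bool" where
  "ext_concave G \<longleftrightarrow>
    (\<forall>l\<in>{0<..<1}. \<forall>s t. G s > - \<infinity> \<longrightarrow> G t > - \<infinity> \<longrightarrow>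
      ereal (1 - l) * G s + ereal l * G t \<le> G ((1 - l) * s + l * t))"

end

theory Submission
  imports Defs "HOL-Real_Asymp.Real_Asymp"
begin

text \<open>If \<open>f(X)\<close> has the law of \<open>\<phi>(Z)\<close> with \<open>\<phi>\<close> convex, then \<open>\<mu>{f \<le> t}\<close> is the Gaussian measure of the
  interval \<open>{\<phi> \<le> t}\<close>, and these intervals satisfy
  \<open>(1 - l){\<phi> \<le> s} + l{\<phi> \<le> t} \<subseteq> {\<phi> \<le> (1 - l)s + lt}\<close>; concavity is then the one-dimensional Ehrhard
  inequality. For bounded intervals the latter says that \<open>Phi\<^sup>-\<^sup>1(Phi b - Phi a)\<close> is concave in \<open>(a, b)\<close>.
  Its Hessian is negative semidefinite because \<open>std_normal_density x / x\<close> is a superadditive function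
  of the tail probability \<open>1 - Phi x\<close>; closed intervals of infinite length follow by truncation.

  Conversely, if \<open>F\<close> is the distribution function of \<open>f(X)\<close>, the generalised inverse
  \<open>\<phi> z = Inf {t. Phi z \<le> F t} = Inf {t. z \<le> Phi_inv (F t)}\<close> of the concave function
  \<open>Phi_inv \<circ> F\<close> is convex, and \<open>\<phi>(Z)\<close> has distribution function \<open>F\<close>.\<close>

subsection \<open>The standard normal distribution function\<close>

definition gauss :: "real measure" where
  "gauss = density lborel (\<lambda>x. ennreal (std_normal_density x))"

abbreviation Phi_quantile :: "real \<Rightarrow> real" where
  "Phi_quantile \<equiv> inv_into UNIV Phi"

lemma sets_gauss [simp, measurable_cong]: "sets gauss = sets borel"
  and space_gauss [simp]: "space gauss = UNIV"
  by (simp_all add: gauss_def)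

lemma real_distribution_gauss: "real_distribution gauss"
  unfolding real_distribution_def real_distribution_axioms_def gauss_def
  by (auto intro: prob_space_normal_density)

interpretation gauss: real_distribution gauss
  by (rule real_distribution_gauss)

lemma measure_gauss:
  assumes "A \<in> sets borel"
  shows "measure gauss A = (LINT x:A|lborel. std_normal_density x)"
proof -
  have "measure gauss A = enn2real (\<integral>\<^sup>+x. ennreal (indicator A x * std_normal_density x) \<partial>lborel)"
    using assms unfolding gauss_def measure_def
    by (subst emeasure_density)
       (auto intro!: arg_cong[where f=enn2real] nn_integral_cong split: split_indicator)
  also have "\<dots> = (LINT x:A|lborel. std_normal_density x)"
    using assms unfolding set_lebesgue_integral_def
    by (subst integral_eq_nn_integral) auto
  finally show ?thesis .
qed

lemma Phi_eq_cdf: "Phi = cdf gauss"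
  by (rule ext) (simp add: cdf_def measure_gauss Phi_def std_normal_density_def)

lemma measure_gauss_singleton: "measure gauss {x} = 0"
  using AE_lborel_singleton[of x]
  by (subst measure_gauss) (auto simp: set_lebesgue_integral_def intro!: integral_eq_zero_AE)

lemma measure_gauss_Icc: "a \<le> b \<Longrightarrow> measure gauss {a..b} = Phi b - Phi a"
proof -
  assume "a \<le> b"
  have "measure gauss {a..b} = measure gauss {..b} - measure gauss {..<a}"
    using \<open>a \<le> b\<close> by (subst gauss.finite_measure_Diff[symmetric]) (auto intro!: arg_cong[where f="measure gauss"])
  moreover have "measure gauss {..a} = measure gauss {..<a} + measure gauss {a}"
    by (subst gauss.finite_measure_Union[symmetric]) (auto intro!: arg_cong[where f="measure gauss"])
  ultimately show ?thesis
    by (simp add: Phi_eq_cdf cdf_def measure_gauss_singleton)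
qed

lemma continuous_on_std_normal_density: "continuous_on A std_normal_density"
  unfolding std_normal_density_def by (intro continuous_intros) auto

lemma std_normal_density_pos [simp]: "std_normal_density x > 0"
  by (simp add: normal_density_pos)

lemma Phi_has_derivative: "(Phi has_real_derivative std_normal_density x) (at x)"
proof -
  \<comment> \<open>Starting the integral strictly to the left of \<open>x\<close> makes
    \<open>x\<close> an interior point of \<open>{a..x + 1}\<close>, so the one-sided fundamental
    theorem yields a two-sided derivative.\<close>
  define a where "a = x - 1"
  have eq: "Phi t = Phi a + integral {a..t} std_normal_density" if "a \<le> t" for t
  proof -
    have "set_integrable lborel {a..t} std_normal_density"
      by (rule borel_integrable_atLeastAtMost') (rule continuous_on_std_normal_density)
    then have "integral {a..t} std_normal_density = measure gauss {a..t}"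
      by (simp add: measure_gauss set_borel_integral_eq_integral)
    then show ?thesis
      using that by (simp add: measure_gauss_Icc)
  qed
  have "((\<lambda>t. Phi a + integral {a..t} std_normal_density) has_real_derivative std_normal_density x)
      (at x within {a..x + 1})"
    using integral_has_real_derivative[OF continuous_on_std_normal_density, of x a "x + 1"]
    by (auto simp: a_def intro!: derivative_eq_intros)
  then have "((\<lambda>t. Phi a + integral {a..t} std_normal_density) has_real_derivative std_normal_density x)
      (at x)"
    by (simp add: at_within_Icc_at a_def)
  moreover have "x \<in> {a<..}"
    by (simp add: a_def)
  ultimately show ?thesis
    by (rule has_field_derivative_transform_within_open[OF _ open_greaterThan])
       (simp add: eq[symmetric])
qed

lemma std_normal_density_has_derivative:
  "(std_normal_density has_real_derivative - x * std_normal_density x) (at x)"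
  unfolding std_normal_density_def by (auto intro!: derivative_eq_intros simp: field_simps power2_eq_square)

declare DERIV_chain2[OF Phi_has_derivative, derivative_intros]
  and DERIV_chain2[OF std_normal_density_has_derivative, derivative_intros]

lemma isCont_Phi: "isCont Phi x"
  using Phi_has_derivative DERIV_isCont by blast

lemma strict_mono_Phi: "strict_mono Phi"
  by (rule strict_monoI, rule DERIV_pos_imp_increasing)
     (use Phi_has_derivative std_normal_density_pos in blast)+

lemmas Phi_less_iff [simp] = strict_mono_less[OF strict_mono_Phi]
  and Phi_le_iff [simp] = strict_mono_less_eq[OF strict_mono_Phi]

lemma Phi_pos [simp]: "0 < Phi x"
  using Phi_less_iff[of "x - 1" x] gauss.cdf_nonneg[of "x - 1"] unfolding Phi_eq_cdf by linarith

lemma Phi_less_1 [simp]: "Phi x < 1"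
  using Phi_less_iff[of x "x + 1"] gauss.cdf_bounded_prob[of "x + 1"] unfolding Phi_eq_cdf by linarith

lemma Phi_at_top: "(Phi \<longlongrightarrow> 1) at_top"
  unfolding Phi_eq_cdf by (rule gauss.cdf_lim_at_top_prob)

lemma Phi_at_bot: "(Phi \<longlongrightarrow> 0) at_bot"
  unfolding Phi_eq_cdf by (rule gauss.cdf_lim_at_bot)

lemma Phi_surj:
  assumes "0 < p" "p < 1"
  obtains x where "Phi x = p"
proof -
  obtain a where a: "Phi a < p"
    using order_tendstoD(2)[OF Phi_at_bot assms(1)] by (meson eventually_at_bot_linorder order_refl)
  obtain b where b: "p < Phi b"
    using order_tendstoD(1)[OF Phi_at_top assms(2)] by (meson eventually_at_top_linorder order_refl)
  have "a \<le> b"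
    using a b Phi_less_iff[of a b] by linarith
  then show ?thesis
    using IVT[of Phi a p b] a b isCont_Phi that by auto
qed

section \<open>The inverse of the distribution function\<close>

lemma Phi_Phi_quantile: "0 < p \<Longrightarrow> p < 1 \<Longrightarrow> Phi (Phi_quantile p) = p"
  by (metis Phi_surj f_inv_into_f rangeI)

lemma Phi_quantile_Phi [simp]: "Phi_quantile (Phi x) = x"
  using strict_mono_Phi by (simp add: strict_mono_imp_inj_on)

lemma Phi_quantile_has_derivative:
  assumes "0 < p" "p < 1"
  shows "(Phi_quantile has_real_derivative inverse (std_normal_density (Phi_quantile p))) (at p)"
proof (rule DERIV_inverse_function[OF Phi_has_derivative])
  show "isCont Phi_quantile p"
    using isCont_inverse_function[of 1 "Phi_quantile p" Phi_quantile Phi] assms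
    by (simp add: Phi_Phi_quantile isCont_Phi)
qed (use assms in \<open>auto simp: Phi_Phi_quantile less_imp_neq[symmetric]\<close>)

text \<open>A Galois connection that hides the infinite values of \<open>Phi_inv\<close>: since
  \<open>Phi z\<close> lies strictly between 0 and 1, both sides fail at \<open>p = 0\<close> and
  hold at \<open>p = 1\<close>.\<close>

lemma le_Phi_inv_iff:
  assumes "0 \<le> p" "p \<le> 1"
  shows "ereal z \<le> Phi_inv p \<longleftrightarrow> Phi z \<le> p"
proof -
  consider "p = 0" | "p = 1" | "0 < p" "p < 1"
    using assms by linarith
  then show ?thesis
  proof cases
    case 3
    then obtain x where "Phi x = p"
      by (rule Phi_surj)
    with 3 show ?thesis
      by (auto simp: Phi_inv_def)
  qed (auto simp: Phi_inv_def not_le less_imp_le)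
qed

lemma std_normal_density_uminus [simp]: "std_normal_density (- x) = std_normal_density x"
  by (simp add: std_normal_density_def)

text \<open>The density is even, so \<open>Phi t + Phi (- t)\<close> has derivative zero; its
  constant value is its limit at infinity.\<close>

lemma Phi_uminus: "Phi (- x) = 1 - Phi x"
proof -
  have D: "((\<lambda>t. Phi t + Phi (- t)) has_real_derivative 0) (at t)" for t
    by (auto intro!: derivative_eq_intros)
  have const: "(\<lambda>t. Phi t + Phi (- t)) = (\<lambda>t. Phi x + Phi (- x))"
    using DERIV_isconst_all[OF allI[OF D]] by blast
  have "((\<lambda>t. Phi t + Phi (- t)) \<longlongrightarrow> 1 + 0) at_top"
    by (intro tendsto_add Phi_at_top filterlim_compose[OF Phi_at_bot] filterlim_uminus_at_bot_at_top)
  then show ?thesis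
    unfolding const by (simp add: tendsto_const_iff)
qed

subsection \<open>Ehrhard's inequality for intervals\<close>

lemma Phi_diff_le_mills_ratio:
  assumes "0 < h" "h \<le> x"
  shows "(1 + 1 / x\<^sup>2) * (Phi x - Phi h) \<le> std_normal_density h / h - std_normal_density x / x"
proof -
  \<comment> \<open>The derivative of \<open>std_normal_density s / s\<close> is
    \<open>- (1 + 1 / s\<^sup>2) * std_normal_density s\<close>; on \<open>{h..x}\<close> the factor
    \<open>1 + 1 / s\<^sup>2\<close> is smallest at \<open>x\<close>.\<close>
  define g where "g = (\<lambda>s. std_normal_density s / s + (1 + 1 / x\<^sup>2) * Phi s)"
  have "g x \<le> g h"
  proof (rule DERIV_nonpos_imp_nonincreasing[OF \<open>h \<le> x\<close>])
    fix s assume s: "h \<le> s" "s \<le> x"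
    have "(g has_real_derivative (1 / x\<^sup>2 - 1 / s\<^sup>2) * std_normal_density s) (at s)"
      unfolding g_def using s assms
      by (auto intro!: derivative_eq_intros simp: field_simps power2_eq_square)
    moreover have "1 / x\<^sup>2 \<le> 1 / s\<^sup>2"
      using s assms by (intro divide_left_mono power_mono) auto
    ultimately show "\<exists>y. (g has_real_derivative y) (at s) \<and> y \<le> 0"
      by (auto intro!: exI mult_nonpos_nonneg)
  qed
  then show ?thesis
    by (simp add: g_def right_diff_distrib)
qed

text \<open>The same derivative on \<open>{y..}\<close>, where the factor
  \<open>1 + 1 / s\<^sup>2\<close> is largest at \<open>y\<close>: the difference \<open>g\<close>
  of the two sides is nondecreasing there and tends to 0.\<close>

lemma mills_ratio_le_tail:
  assumes "0 < y"
  shows "std_normal_density y / y \<le> (1 + 1 / y\<^sup>2) * (1 - Phi y)"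
proof -
  define g where "g = (\<lambda>s. std_normal_density s / s - (1 + 1 / y\<^sup>2) * (1 - Phi s))"
  have mono: "g y \<le> g x" if "y \<le> x" for x
  proof (rule DERIV_nonneg_imp_nondecreasing[OF that])
    fix s assume s: "y \<le> s" "s \<le> x"
    have "(g has_real_derivative (1 / y\<^sup>2 - 1 / s\<^sup>2) * std_normal_density s) (at s)"
      unfolding g_def using s assms
      by (auto intro!: derivative_eq_intros simp: field_simps power2_eq_square)
    moreover have "1 / s\<^sup>2 \<le> 1 / y\<^sup>2"
      using s assms by (intro divide_left_mono power_mono) auto
    ultimately show "\<exists>d. (g has_real_derivative d) (at s) \<and> 0 \<le> d"
      by (auto intro!: exI mult_nonneg_nonneg)
  qed
  have "((\<lambda>s. std_normal_density s / s) \<longlongrightarrow> 0) at_top"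
    unfolding std_normal_density_def by real_asymp
  then have "(g \<longlongrightarrow> 0 - (1 + 1 / y\<^sup>2) * (1 - 1)) at_top"
    unfolding g_def by (intro tendsto_intros Phi_at_top)
  then have "g y \<le> 0"
    using mono by (intro tendsto_lowerbound[of g _ at_top "g y"])
      (auto intro: eventually_mono[OF eventually_ge_at_top[of y]])
  then show ?thesis
    by (simp add: g_def)
qed

text \<open>As a function of the tail probability \<open>1 - Phi x\<close>, the quantity \<open>std_normal_density x / x\<close> has the
  increasing derivative \<open>1 + 1 / x\<^sup>2\<close> and vanishes at \<open>0\<close>; hence it is superadditive.\<close>

lemma mills_ratio_superadditive:
  assumes "0 < h" and tail: "1 - Phi h = (1 - Phi x) + (1 - Phi y)"
  shows "std_normal_density x / x + std_normal_density y / y \<le> std_normal_density h / h"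
proof -
  have main: "std_normal_density x / x + std_normal_density y / y \<le> std_normal_density h / h"
    if "1 - Phi h = (1 - Phi x) + (1 - Phi y)" "x \<le> y" for x y
  proof -
    have "Phi h < Phi x"
      using that(1) Phi_less_1[of y] by linarith
    then have x: "0 < x" "h \<le> x"
      using \<open>0 < h\<close> by auto
    have "1 / y\<^sup>2 \<le> 1 / x\<^sup>2"
      using x \<open>x \<le> y\<close> by (intro divide_left_mono power_mono) auto
    then have "(1 + 1 / y\<^sup>2) * (1 - Phi y) \<le> (1 + 1 / x\<^sup>2) * (1 - Phi y)"
      by (intro mult_right_mono) (auto simp: less_imp_le)
    \<comment> \<open>The tail of \<open>y\<close> has the same mass as the interval from
      \<open>h\<close> to \<open>x\<close>, which lies closer to the origin and so has the larger
      factor.\<close>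
    moreover have "1 - Phi y = Phi x - Phi h"
      using that(1) by linarith
    ultimately show ?thesis
      using Phi_diff_le_mills_ratio[OF \<open>0 < h\<close> x(2)] mills_ratio_le_tail[of y] x \<open>x \<le> y\<close> by simp
  qed
  show ?thesis
    using main[of x y] main[of y x] tail by (cases "x \<le> y") (auto simp: add.commute)
qed

text \<open>For a fixed sum \<open>X + Y\<close>, the minimum of the right-hand side is
  \<open>B * C / (B + C) * (X + Y)\<^sup>2\<close>; the excess over it is an explicit
  square.\<close>

lemma cauchy_harmonic:
  fixes A B C X Y :: real
  assumes "A > 0" "B > 0" "C > 0" and "1 / B + 1 / C \<le> 1 / A"
  shows "A * (X + Y)\<^sup>2 \<le> B * X\<^sup>2 + C * Y\<^sup>2"
proof -
  have "A \<le> B * C / (B + C)"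
    using assms by (simp add: field_simps)
  then have "A * (X + Y)\<^sup>2 \<le> B * C / (B + C) * (X + Y)\<^sup>2"
    by (intro mult_right_mono) auto
  also have "\<dots> = B * X\<^sup>2 + C * Y\<^sup>2 - (B * X - C * Y)\<^sup>2 / (B + C)"
    using assms by (simp add: divide_simps) (simp add: algebra_simps power2_eq_square)
  also have "\<dots> \<le> B * X\<^sup>2 + C * Y\<^sup>2"
    using assms by simp
  finally show ?thesis .
qed

text \<open>This is the sign of the Hessian in \<open>ehrhard_interval\<close>, with
  \<open>x = b\<close> and \<open>y = - a\<close>. When all coefficients are positive, the condition
  of \<open>cauchy_harmonic\<close> is exactly \<open>mills_ratio_superadditive\<close>.\<close>

lemma mills_quadratic_form:
  assumes "Phi h = Phi x + Phi y - 1"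
  shows "h / std_normal_density h * (X + Y)\<^sup>2
    \<le> x / std_normal_density x * X\<^sup>2 + y / std_normal_density y * Y\<^sup>2"
proof -
  have *: "h / std_normal_density h * (X + Y)\<^sup>2
      \<le> x / std_normal_density x * X\<^sup>2 + y / std_normal_density y * Y\<^sup>2"
    if "Phi h = Phi x + Phi y - 1" "x \<le> y" for h x y X Y :: real
  proof -
    have "Phi h < Phi x" "Phi h < Phi y"
      using that(1) Phi_less_1[of x] Phi_less_1[of y] by linarith+
    then have hx: "h < x" "h < y"
      by auto
    \<comment> \<open>Otherwise \<open>Phi x\<close> and \<open>Phi y\<close> are both at most
      \<open>Phi 0 = 1 / 2\<close>, which would make \<open>Phi h\<close> nonpositive.\<close>
    have "0 < y"
    proof (rule ccontr)
      assume "\<not> 0 < y"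
      then have "Phi x \<le> Phi 0" "Phi y \<le> Phi 0"
        using that(2) by (simp_all del: Phi_less_iff)
      then show False
        using that(1) Phi_uminus[of 0] Phi_pos[of h] by (simp del: Phi_le_iff)
    qed
    consider "0 < h" | "h \<le> 0" "0 \<le> x" | "h < 0" "x < 0"
      using hx by linarith
    then show ?thesis
    proof cases
      case 1
      then show ?thesis
        using hx that mills_ratio_superadditive[of h x y] by (intro cauchy_harmonic) auto
    next
      case 2
      then have "h / std_normal_density h * (X + Y)\<^sup>2 \<le> 0"
        by (intro mult_nonpos_nonneg divide_nonpos_nonneg) auto
      moreover have "0 \<le> x / std_normal_density x * X\<^sup>2 + y / std_normal_density y * Y\<^sup>2"
        using 2 \<open>0 < y\<close> by (intro add_nonneg_nonneg mult_nonneg_nonneg divide_nonneg_nonneg) auto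
      ultimately show ?thesis
        by linarith
    next
      case 3
      \<comment> \<open>The hypothesis also says that the tail at \<open>- x\<close> is the sum of
        the tails at \<open>- h\<close> and \<open>y\<close>. With these three positive points the
        inequality is the desired one with two terms moved across.\<close>
      have "- x / std_normal_density x * ((X + Y) + - Y)\<^sup>2
          \<le> - h / std_normal_density h * (X + Y)\<^sup>2 + y / std_normal_density y * (- Y)\<^sup>2"
        using 3 \<open>0 < y\<close> that mills_ratio_superadditive[of "- x" "- h" y]
        by (intro cauchy_harmonic) (auto simp: Phi_uminus divide_neg_pos)
      then show ?thesis
        by simp
    qed
  qed
  show ?thesis
    using *[of h x y X Y] *[of h y x Y X] assms
    by (cases "x \<le> y") (auto simp: add.commute)
qed

text \<open>Along the segment from \<open>(a0, b0)\<close> to \<open>(a1, b1)\<close>, the quantile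
  \<open>h\<close> of the interval's measure has nonpositive second derivative.\<close>

lemma ehrhard_interval:
  assumes "a0 < b0" "a1 < b1" "0 \<le> l" "l \<le> 1"
    and h0: "Phi h0 = Phi b0 - Phi a0" and h1: "Phi h1 = Phi b1 - Phi a1"
  shows "Phi ((1 - l) * h0 + l * h1) \<le> Phi ((1 - l) * b0 + l * b1) - Phi ((1 - l) * a0 + l * a1)"
proof -
  define dx dy where "dx = b1 - b0" and "dy = a0 - a1"
  \<comment> \<open>Taking \<open>y\<close> as minus the left endpoint makes the measure symmetric:
    \<open>Phi x - Phi (- y) = Phi x + Phi y - 1\<close>.\<close>
  define x y where "x = (\<lambda>s. b0 + s * dx)" and "y = (\<lambda>s. - a0 + s * dy)"
  define p where "p = (\<lambda>s. Phi (x s) + Phi (y s) - 1)"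
  define h where "h = (\<lambda>s. Phi_quantile (p s))"
  define C where "C = {s. 0 < x s + y s}"
  define n where "n = std_normal_density"
  have n0: "n s > 0" for s
    by (simp add: n_def)
  have p: "p s = Phi (x s) - Phi (- y s)" for s
    by (simp add: p_def Phi_uminus)
  have p01: "0 < p s" "p s < 1" if "s \<in> C" for s
  proof -
    show "0 < p s"
      using that by (simp add: p C_def)
    show "p s < 1"
      using Phi_less_1[of "x s"] Phi_pos[of "- y s"] unfolding p by linarith
  qed
  have h: "Phi (h s) = p s" if "s \<in> C" for s
    using p01[OF that] by (simp add: h_def Phi_Phi_quantile)
  have Dx: "(x has_real_derivative dx) (at s)" and Dy: "(y has_real_derivative dy) (at s)" for s
    by (auto simp: x_def y_def intro!: derivative_eq_intros)
  define h' where "h' = (\<lambda>s. (dx * n (x s) + dy * n (y s)) / n (h s))"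
  \<comment> \<open>Differentiating \<open>Phi (h s) = p s\<close> twice gives this, arranged so
    that \<open>mills_quadratic_form\<close> applies with \<open>X = dx * n (x s)\<close> and
    \<open>Y = dy * n (y s)\<close>.\<close>
  define h'' where "h'' = (\<lambda>s. (h s / n (h s) * (dx * n (x s) + dy * n (y s))\<^sup>2
    - x s / n (x s) * (dx * n (x s))\<^sup>2 - y s / n (y s) * (dy * n (y s))\<^sup>2) / n (h s))"
  have "convex C"
  proof -
    have "C = {s. inner (- (dx + dy)) s < b0 - a0}"
      by (auto simp: C_def x_def y_def algebra_simps)
    then show ?thesis
      using convex_halfspace_lt by metis
  qed
  have Dp: "(p has_real_derivative dx * n (x s) + dy * n (y s)) (at s)" for s
    unfolding p_def n_def by (auto intro!: derivative_eq_intros Dx Dy)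
  have Dh: "(h has_real_derivative h' s) (at s)" if "s \<in> C" for s
    using DERIV_chain2[OF Phi_quantile_has_derivative[OF p01[OF that]] Dp]
    by (simp add: h_def h'_def n_def field_simps)
  have Dh': "(h' has_real_derivative h'' s) (at s)" if "s \<in> C" for s
  proof -
    have Dn: "((\<lambda>r. n (f r)) has_real_derivative - f s * n (f s) * d) (at s)"
      if "(f has_real_derivative d) (at s)" for f d
      unfolding n_def by (rule DERIV_chain2[OF std_normal_density_has_derivative that])
    have *: "((- X * A * dx * dx + - Y * B * dy * dy) * c - (dx * A + dy * B) * (- H * c * ((dx * A + dy * B) / c)))
        / (c * c) = (H / c * (dx * A + dy * B)\<^sup>2 - X / A * (dx * A)\<^sup>2 - Y / B * (dy * B)\<^sup>2) / c"
      if "A > 0" "B > 0" "c > 0" for A B c X Y H :: real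
    proof -
      have "X / A * (dx * A)\<^sup>2 = X * A * dx * dx" "Y / B * (dy * B)\<^sup>2 = Y * B * dy * dy"
        using that by (simp_all add: power2_eq_square)
      then show ?thesis
        using that by (simp add: field_simps power2_eq_square)
    qed
    have "(h' has_real_derivative ((- x s * n (x s) * dx * dx + - y s * n (y s) * dy * dy) * n (h s)
        - (dx * n (x s) + dy * n (y s)) * (- h s * n (h s) * h' s)) / (n (h s) * n (h s))) (at s)"
      unfolding h'_def
      using n0[of "h s"]
      by (auto intro!: derivative_eq_intros Dn[OF Dx] Dn[OF Dy] Dn[OF Dh[OF that]] simp: h'_def)
    then show ?thesis
      using *[OF n0 n0 n0] by (simp add: h''_def h'_def)
  qed
  have "h'' s \<le> 0" if "s \<in> C" for s
    using mills_quadratic_form[of "h s" "x s" "y s" "dx * n (x s)" "dy * n (y s)"] h[OF that] n0[of "h s"]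
    unfolding h''_def n_def p_def
    by (intro divide_nonpos_nonneg) auto
  with f''_le0_imp_concave[OF \<open>convex C\<close> Dh Dh'] have conc: "concave_on C h"
    by blast
  have "0 \<in> C" "1 \<in> C"
    using assms by (auto simp: C_def x_def y_def dx_def dy_def)
  then have "(1 - l) * h 0 + l * h 1 \<le> h l" and lC: "l \<in> C"
    using concave_onD[OF conc, of l 0 1] convexD_alt[OF \<open>convex C\<close>, of 0 1 l] assms by auto
  moreover have "h 0 = h0"
    by (simp add: h_def p x_def y_def h0[symmetric])
  moreover have "h 1 = h1"
    by (simp add: h_def p x_def y_def dx_def dy_def h1[symmetric])
  ultimately have "Phi ((1 - l) * h0 + l * h1) \<le> Phi (h l)"
    by simp
  also have "\<dots> = Phi (x l) - Phi (- y l)"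
    using h[OF lC] by (simp add: p)
  finally show ?thesis
    by (simp add: x_def y_def dx_def dy_def algebra_simps)
qed

subsection \<open>Ehrhard's inequality for closed convex sets\<close>

text \<open>Truncation to \<open>{- real n..real n}\<close> loses arbitrarily little mass and leaves
  a compact connected set, hence a compact interval.\<close>

lemma convex_inner_interval:
  assumes "convex A" "closed A" "0 \<le> c" "c < measure gauss A"
  obtains a b where "a < b" "{a..b} \<subseteq> A" "c < Phi b - Phi a"
proof -
  have "(\<lambda>n. measure gauss (A \<inter> {- real n..real n})) \<longlonglongrightarrow> measure gauss (\<Union>n. A \<inter> {- real n..real n})"
    using assms(2) by (intro gauss.finite_Lim_measure_incseq) (auto simp: incseq_def)
  also have "(\<Union>n. A \<inter> {- real n..real n}) = A"
  proof -
    have "\<exists>n. - real n \<le> x \<and> x \<le> real n" for x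
      using real_arch_simple[of "\<bar>x\<bar>"] by (auto simp: abs_le_iff minus_le_iff)
    then show ?thesis
      by auto
  qed
  finally have "\<forall>\<^sub>F n in sequentially. c < measure gauss (A \<inter> {- real n..real n})"
    using assms(4) by (rule order_tendstoD(1))
  then obtain n where n: "c < measure gauss (A \<inter> {- real n..real n})"
    by (auto simp: eventually_sequentially)
  have "connected (A \<inter> {- real n..real n})" "compact (A \<inter> {- real n..real n})"
    using assms by (auto intro!: convex_connected convex_Int closed_Int_compact)
  then obtain a b where ab: "A \<inter> {- real n..real n} = {a..b}"
    using connected_compact_interval_1 by meson
  then have "c < measure gauss {a..b}"
    using n by simp
  then have "a \<le> b"
    using \<open>0 \<le> c\<close> by (cases "a \<le> b") auto
  with \<open>c < measure gauss {a..b}\<close> have "c < Phi b - Phi a"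
    by (simp add: measure_gauss_Icc)
  moreover have "a < b"
    using \<open>c < Phi b - Phi a\<close> \<open>0 \<le> c\<close> Phi_less_iff[of a b] by linarith
  ultimately show ?thesis
    using that ab by blast
qed

text \<open>Lowering \<open>h0\<close> and \<open>h1\<close> by \<open>e\<close> leaves room for
  inner compact intervals, to which \<open>ehrhard_interval\<close> applies; continuity of
  \<open>Phi\<close> then removes \<open>e\<close>.\<close>

lemma ehrhard_convex:
  assumes "convex A" "closed A" "convex B" "closed B" "convex C" "closed C"
    and l: "0 \<le> l" "l \<le> 1"
    and sub: "\<And>a b. a \<in> A \<Longrightarrow> b \<in> B \<Longrightarrow> (1 - l) * a + l * b \<in> C"
    and A: "Phi h0 \<le> measure gauss A" and B: "Phi h1 \<le> measure gauss B"
  shows "Phi ((1 - l) * h0 + l * h1) \<le> measure gauss C"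
proof -
  define h where "h = (1 - l) * h0 + l * h1"
  have approx: "Phi (h - e) \<le> measure gauss C" if "e > 0" for e
  proof -
    have "Phi (h0 - e) < measure gauss A" "Phi (h1 - e) < measure gauss B"
      using A B Phi_less_iff[of "h0 - e" h0] Phi_less_iff[of "h1 - e" h1] that by linarith+
    then obtain a0 b0 a1 b1 where
      0: "a0 < b0" "{a0..b0} \<subseteq> A" "Phi (h0 - e) < Phi b0 - Phi a0" and
      1: "a1 < b1" "{a1..b1} \<subseteq> B" "Phi (h1 - e) < Phi b1 - Phi a1"
      using convex_inner_interval assms(1-4) Phi_pos less_imp_le by metis
    have "Phi b0 - Phi a0 < 1" "Phi b1 - Phi a1 < 1"
      using Phi_less_1[of b0] Phi_pos[of a0] Phi_less_1[of b1] Phi_pos[of a1] by linarith+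
    with 0 1 obtain k0 k1 where k: "Phi k0 = Phi b0 - Phi a0" "Phi k1 = Phi b1 - Phi a1"
      by (metis Phi_surj Phi_less_iff diff_gt_0_iff_gt)
    with 0 1 have ge: "h0 - e \<le> k0" "h1 - e \<le> k1"
      by (metis Phi_less_iff less_imp_le)+
    define a b where "a = (1 - l) * a0 + l * a1" and "b = (1 - l) * b0 + l * b1"
    have "a \<le> b"
      using 0 1 l by (auto simp: a_def b_def intro!: add_mono mult_left_mono)
    have "a \<in> C" "b \<in> C"
      using 0 1 by (auto simp: a_def b_def intro!: sub)
    then have "{a..b} \<subseteq> C"
      using closed_segment_subset[OF _ _ \<open>convex C\<close>, of a b] \<open>a \<le> b\<close>
      by (simp add: closed_segment_eq_real_ivl)
    have "h - e = (1 - l) * (h0 - e) + l * (h1 - e)"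
      by (simp add: h_def algebra_simps)
    also have "\<dots> \<le> (1 - l) * k0 + l * k1"
      using ge l by (intro add_mono mult_left_mono) auto
    finally have "Phi (h - e) \<le> Phi ((1 - l) * k0 + l * k1)"
      by simp
    also have "\<dots> \<le> Phi b - Phi a"
      unfolding a_def b_def by (rule ehrhard_interval) (use 0 1 l k in auto)
    also have "\<dots> = measure gauss {a..b}"
      using \<open>a \<le> b\<close> by (simp add: measure_gauss_Icc)
    also have "\<dots> \<le> measure gauss C"
      using \<open>{a..b} \<subseteq> C\<close> \<open>closed C\<close> by (intro gauss.finite_measure_mono) auto
    finally show ?thesis .
  qed
  have "((\<lambda>e. Phi (h - e)) \<longlongrightarrow> Phi (h - 0)) (at_right 0)"
    by (intro isCont_tendsto_compose[OF isCont_Phi] tendsto_intros)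
  then have "Phi (h - 0) \<le> measure gauss C"
    by (rule tendsto_upperbound) (auto intro!: eventually_at_rightI[of 0 1] approx)
  then show ?thesis
    by (simp add: h_def)
qed

subsection \<open>Convex functions of a Gaussian variable\<close>

text \<open>It suffices to test real minorants of \<open>g0\<close> and \<open>g1\<close>, the form
  in which \<open>le_Phi_inv_iff\<close> turns concavity into a statement about
  \<open>Phi\<close>.\<close>

lemma ereal_convex_combination_leI:
  fixes g g0 g1 :: ereal
  assumes "0 < l" "l < 1" "- \<infinity> < g0" "- \<infinity> < g1"
    and le: "\<And>h0 h1. ereal h0 \<le> g0 \<Longrightarrow> ereal h1 \<le> g1 \<Longrightarrow> ereal ((1 - l) * h0 + l * h1) \<le> g"
  shows "ereal (1 - l) * g0 + ereal l * g1 \<le> g"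
proof (cases "g0 = \<infinity> \<or> g1 = \<infinity>")
  case False
  with assms(3,4) obtain r0 r1 where "g0 = ereal r0" "g1 = ereal r1"
    by (cases g0; cases g1) auto
  with le[of r0 r1] show ?thesis
    by simp
next
  case True
  obtain r0 r1 where r: "ereal r0 \<le> g0" "ereal r1 \<le> g1"
    using assms(3,4) by (meson ereal_dense2 less_imp_le)
  \<comment> \<open>The minorant on the infinite side is free, so it is chosen to make the convex
    combination equal to \<open>c\<close>.\<close>
  have "ereal c \<le> g" for c
    using True
  proof
    assume "g0 = \<infinity>"
    then show ?thesis
      using le[of "(c - l * r1) / (1 - l)" r1] r \<open>l < 1\<close> by simp
  next
    assume "g1 = \<infinity>"
    then show ?thesis
      using le[of r0 "(c - (1 - l) * r0) / l"] r \<open>0 < l\<close> by simp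
  qed
  then have "g = \<infinity>"
    by (metis ereal_top)
  then show ?thesis
    by simp
qed

lemma borel_measurable_convex_on_UNIV:
  fixes \<phi> :: "real \<Rightarrow> real"
  shows "convex_on UNIV \<phi> \<Longrightarrow> \<phi> \<in> borel_measurable borel"
  by (intro borel_measurable_continuous_onI convex_on_continuous) auto

lemma ext_concave_convex_image:
  assumes \<phi>: "convex_on UNIV \<phi>"
  shows "ext_concave (\<lambda>t. Phi_inv (measure gauss {z. \<phi> z \<le> t}))"
  unfolding ext_concave_def
proof (intro ballI allI impI ereal_convex_combination_leI)
  fix l s t :: real and h0 h1
  assume l: "l \<in> {0<..<1}"
    and h0: "ereal h0 \<le> Phi_inv (measure gauss {z. \<phi> z \<le> s})"
    and h1: "ereal h1 \<le> Phi_inv (measure gauss {z. \<phi> z \<le> t})"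
  have conv: "convex {z. \<phi> z \<le> c}" for c
  proof (rule convexI)
    fix x y u v :: real
    assume *: "x \<in> {z. \<phi> z \<le> c}" "y \<in> {z. \<phi> z \<le> c}" "0 \<le> u" "0 \<le> v" "u + v = 1"
    then have "\<phi> (u *\<^sub>R x + v *\<^sub>R y) \<le> u * \<phi> x + v * \<phi> y"
      using \<phi> unfolding convex_on_def by blast
    also have "\<dots> \<le> c"
      using * by (intro convex_bound_le) auto
    finally show "u *\<^sub>R x + v *\<^sub>R y \<in> {z. \<phi> z \<le> c}"
      by simp
  qed
  have clos: "closed {z. \<phi> z \<le> c}" for c
    using convex_on_continuous[OF open_UNIV \<phi>] by (intro closed_Collect_le) auto
  have "Phi ((1 - l) * h0 + l * h1) \<le> measure gauss {z. \<phi> z \<le> (1 - l) * s + l * t}"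
  proof (rule ehrhard_convex[OF conv clos conv clos conv clos])
    fix a b assume ab: "a \<in> {z. \<phi> z \<le> s}" "b \<in> {z. \<phi> z \<le> t}"
    have "\<phi> ((1 - l) * a + l * b) \<le> (1 - l) * \<phi> a + l * \<phi> b"
      using convex_onD[OF \<phi>, of l a b] l by simp
    also have "\<dots> \<le> (1 - l) * s + l * t"
      using ab l by (intro add_mono mult_left_mono) auto
    finally show "(1 - l) * a + l * b \<in> {z. \<phi> z \<le> (1 - l) * s + l * t}"
      by simp
  qed (use l h0 h1 in \<open>auto simp: le_Phi_inv_iff\<close>)
  then show "ereal ((1 - l) * h0 + l * h1) \<le> Phi_inv (measure gauss {z. \<phi> z \<le> (1 - l) * s + l * t})"
    by (simp add: le_Phi_inv_iff)
qed auto

section \<open>Laws represented by a convex function of a Gaussian\<close>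

lemma measure_gauss_Phi_le:
  assumes "0 \<le> p" "p \<le> 1"
  shows "measure gauss {z. Phi z \<le> p} = p"
proof -
  consider "p = 0" | "p = 1" | "0 < p" "p < 1"
    using assms by linarith
  then show ?thesis
  proof cases
    case 1
    moreover have "{z. Phi z \<le> 0} = {}"
      by (auto simp: not_le)
    ultimately show ?thesis
      by simp
  next
    case 2
    then show ?thesis
      using gauss.prob_space by (simp add: less_imp_le)
  next
    case 3
    then obtain x where "Phi x = p"
      by (rule Phi_surj)
    moreover from this have "{z. Phi z \<le> p} = {..x}"
      by auto
    ultimately show ?thesis
      by (simp add: Phi_eq_cdf cdf_def)
  qed
qed

lemma cdf_distr_gauss:
  assumes "\<phi> \<in> borel_measurable borel"
  shows "cdf (distr gauss borel \<phi>) t = measure gauss {z. \<phi> z \<le> t}"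
  using assms by (simp add: cdf_def measure_distr vimage_def)

lemma convex_gauss_representation:
  assumes "real_distribution D" and conc: "ext_concave (\<lambda>t. Phi_inv (cdf D t))"
  obtains \<phi> where "convex_on UNIV \<phi>" "distr gauss borel \<phi> = D"
proof -
  interpret D: cdf_distribution D
    using assms(1) by (rule cdf_distribution.intro)
  define \<phi> where "\<phi> = (\<lambda>z. Inf {t. Phi z \<le> cdf D t})"
  \<comment> \<open>Right-continuity of the distribution function makes the infimum attained; it is
    real because \<open>0 < Phi z < 1\<close>.\<close>
  have le_iff: "Phi z \<le> cdf D t \<longleftrightarrow> \<phi> z \<le> t" for z t
    unfolding \<phi>_def by (rule D.pseudoinverse) auto
  \<comment> \<open>Up to swapping coordinates, the epigraph of \<open>\<phi>\<close> is the
    hypograph of \<open>Phi_inv\<close> composed with \<open>cdf D\<close>, so concavity becomes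
    convexity.\<close>
  have inv_iff: "ereal z \<le> Phi_inv (cdf D t) \<longleftrightarrow> \<phi> z \<le> t" for z t
    by (simp add: le_Phi_inv_iff le_iff D.cdf_nonneg D.cdf_bounded_prob)
  have "convex_on UNIV \<phi>"
  proof (rule convex_onI)
    fix l x y :: real assume l: "0 < l" "l < 1"
    have x: "ereal x \<le> Phi_inv (cdf D (\<phi> x))" and y: "ereal y \<le> Phi_inv (cdf D (\<phi> y))"
      by (simp_all add: inv_iff)
    \<comment> \<open>These are the guards of \<open>ext_concave\<close> at the points
      \<open>\<phi> x\<close> and \<open>\<phi> y\<close>.\<close>
    then have fin: "- \<infinity> < Phi_inv (cdf D (\<phi> x))" "- \<infinity> < Phi_inv (cdf D (\<phi> y))"
      by (auto intro: less_le_trans[of _ "ereal _"])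
    have "ereal ((1 - l) * x + l * y) = ereal (1 - l) * ereal x + ereal l * ereal y"
      by simp
    also have "\<dots> \<le> ereal (1 - l) * Phi_inv (cdf D (\<phi> x)) + ereal l * Phi_inv (cdf D (\<phi> y))"
      using l x y by (intro add_mono ereal_mult_left_mono) auto
    also have "\<dots> \<le> Phi_inv (cdf D ((1 - l) * \<phi> x + l * \<phi> y))"
      using conc l fin unfolding ext_concave_def by simp
    finally show "\<phi> ((1 - l) *\<^sub>R x + l *\<^sub>R y) \<le> (1 - l) * \<phi> x + l * \<phi> y"
      by (simp add: inv_iff)
  qed simp
  moreover have "distr gauss borel \<phi> = D"
  proof (rule cdf_unique)
    have m: "\<phi> \<in> borel_measurable borel"
      using calculation by (rule borel_measurable_convex_on_UNIV)
    then show "real_distribution (distr gauss borel \<phi>)"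
      by (intro gauss.real_distribution_distr) simp
    \<comment> \<open>By \<open>le_iff\<close> the event \<open>\<phi> z \<le> t\<close> is
      \<open>Phi z \<le> cdf D t\<close>, and \<open>Phi\<close> of a Gaussian variable is uniform
      on the unit interval.\<close>
    show "cdf (distr gauss borel \<phi>) = cdf D"
      by (rule ext) (simp add: cdf_distr_gauss[OF m] le_iff[symmetric] measure_gauss_Phi_le
          D.cdf_nonneg D.cdf_bounded_prob)
  qed (rule assms(1))
  ultimately show ?thesis
    by (rule that)
qed

theorem theorem4p3:
  fixes M :: "'w measure" and S :: "'a measure" and \<mu> :: "'a measure"
    and X :: "'w \<Rightarrow> 'a" and f :: "'a \<Rightarrow> real"
    and N :: "'v measure" and Z :: "'v \<Rightarrow> real"
  assumes "prob_space M"
    and "X \<in> measurable M S"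
    and "\<mu> = distr M S X"
    and "f \<in> borel_measurable S"
    and "prob_space N"
    and "distributed N lborel Z std_normal_density"
  shows "ext_concave (\<lambda>t. Phi_inv (measure \<mu> {x \<in> space \<mu>. f x \<le> t})) \<longleftrightarrow>
    (\<exists>\<phi> :: real \<Rightarrow> real. convex_on UNIV \<phi> \<and>
      distr M borel (\<lambda>w. f (X w)) = distr N borel (\<lambda>v. \<phi> (Z v)))"
proof -
  note [measurable] = assms(2,4)
  interpret M: prob_space M
    by fact
  define D where "D = distr M borel (\<lambda>w. f (X w))"
  have rd: "real_distribution D"
    unfolding D_def by (rule M.real_distribution_distr) measurable
  have cdf_D: "measure \<mu> {x \<in> space \<mu>. f x \<le> t} = cdf D t" for t
    unfolding assms(3) D_def cdf_def
    by (auto simp: measure_distr intro!: arg_cong[where f="measure M"] dest: measurable_space[OF assms(2)])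
  have Z [measurable]: "Z \<in> borel_measurable N" and "distr N lborel Z = gauss"
    using assms(6) by (auto simp: distributed_def gauss_def)
  \<comment> \<open>Only the sigma-algebra of the target enters \<open>distr\<close>, and
    \<open>lborel\<close> and \<open>borel\<close> share it.\<close>
  then have Zd: "distr N borel Z = gauss"
    by (metis distr_cong sets_lborel)
  have law: "distr N borel (\<lambda>v. \<phi> (Z v)) = distr gauss borel \<phi>" if "convex_on UNIV \<phi>" for \<phi>
    using borel_measurable_convex_on_UNIV[OF that] by (simp add: Zd[symmetric] distr_distr comp_def)
  show ?thesis
    unfolding cdf_D D_def[symmetric]
  proof
    assume "ext_concave (\<lambda>t. Phi_inv (cdf D t))"
    then obtain \<phi> where "convex_on UNIV \<phi>" "distr gauss borel \<phi> = D"
      using convex_gauss_representation[OF rd] by blast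
    then show "\<exists>\<phi>. convex_on UNIV \<phi> \<and> D = distr N borel (\<lambda>v. \<phi> (Z v))"
      using law by metis
  next
    assume "\<exists>\<phi>. convex_on UNIV \<phi> \<and> D = distr N borel (\<lambda>v. \<phi> (Z v))"
    then obtain \<phi> where \<phi>: "convex_on UNIV \<phi>" and "D = distr gauss borel \<phi>"
      using law by auto
    then show "ext_concave (\<lambda>t. Phi_inv (cdf D t))"
      using ext_concave_convex_image[OF \<phi>] borel_measurable_convex_on_UNIV[OF \<phi>]
      by (simp add: cdf_distr_gauss)
  qed
qed

end
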